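(* The following are equivalent: (1) DF: there is $C>0$ such that for all $n$ and all $v\in V_n$, $|v|^2\le C\,a(v,v)$. (2) The projectors $P_n$ are FCO. (3) There exist FCO.
   Context: Setting. $O$ is an infinite dimensional separable real Hilbert space with scalar product $\langle\cdot,\cdot\rangle$ and norm $|\cdot|$. $X\subseteq O$ is a dense subspace, itself a Hilbert space with continuous inclusion $X\to O$. $a$ is a continuous symmetric bilinear form on $X$ with $a(u,u)\ge 0$ for all $u\in X$, such that $\langle\cdot,\cdot\rangle+a$ is coercive on $X$; this form is taken as the scalar product of $X$, so $\|u\|^2=|u|^2+a(u,u)$ is the norm of $X$. Define $W=\{u\in X: a(u,u')=0\ \forall u'\in X\}$ and $V=\{u\in X:\langle u,w\rangle=0\ \forall w\in W\}$, so $X=V\oplus W$. $W$ may be infinite dimensional. It is assumed that the injection $V\to O$ is compact ($V$ carrying the norm of $X$). Discretization. $(X_n)_{n\in\mathbb N}$ is a sequence of finite dimensional subspaces of $X$ satisfying AS: for all $u\in X$, $\lim_{n\to\infty}\inf_{u'\in X_n}\|u-u'\|=0$. Define $W_n=\{u\in X_n: a(u,u')=0\ \forall u'\in X_n\}=X_n\cap W$ and $V_n=\{u\in X_n:\langle u,w\rangle=0\ \forall w\in W_n\}$, so $X_n=V_n\oplus W_n$ ($V_n$ need not be contained in $V$). $P_n:X\to V_n$ is defined by: $P_nu\in V_n$ and $a(P_nu,v)=a(u,v)$ for all $v\in V_n$. Compatible operators. A linear operator $Q_n:X\to X_n$ is compatible with $X_n$ if it maps $W$ into $W_n$ and $u-Q_nu\in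 W_n$ for every $u\in X_n$. A sequence $(Q_n)$ is compatible if each $Q_n$ is compatible with $X_n$. FCO (Friedrichs Compatible Operators) are compatible sequences of operators $(Q_n)$ that are uniformly bounded $X\to X$, i.e. there is $C>0$ with $\|Q_nu\|\le C\|u\|$ for all $n$ and $u\in X$. *)

theory Defs
  imports "HOL-Analysis.Analysis"
begin

text \<open>
  The dense subspace \<open>X \<subseteq> O\<close> carries a Hilbert norm of its own, finer than that of \<open>O\<close>. It is
  therefore a separate type \<open>'x\<close>, whose \<open>norm\<close> and \<open>inner\<close> are those of \<open>X\<close>, and the inclusion
  \<open>X \<rightarrow> O\<close> is an injective bounded linear map \<open>j :: 'x \<Rightarrow> 'o\<close>. Scalar products and norms of \<open>O\<close>
  are \<open>inner (j u) (j v)\<close> and \<open>norm (j u)\<close>.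
\<close>

definition finite_dim :: "'v::real_vector set \<Rightarrow> bool" where
  "finite_dim S \<longleftrightarrow> (\<exists>B. finite B \<and> span B = S)"

definition compact_on :: "'v::real_normed_vector set \<Rightarrow> ('v \<Rightarrow> 'w::real_normed_vector) \<Rightarrow> bool" where
  "compact_on S f \<longleftrightarrow> (\<forall>B. B \<subseteq> S \<and> bounded B \<longrightarrow> compact (closure (f ` B)))"

text \<open>
  For a subspace \<open>Y\<close> of \<open>X\<close>: the kernel of \<open>a\<close> on \<open>Y\<close>, and its \<open>O\<close>-orthogonal complement in \<open>Y\<close>.
  Thus \<open>W = ker_form a UNIV\<close>, \<open>V = ker_compl j a UNIV\<close>, \<open>W\<^sub>n = ker_form a (Xn n)\<close> and
  \<open>V\<^sub>n = ker_compl j a (Xn n)\<close>.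
\<close>

definition ker_form :: "('x \<Rightarrow> 'x \<Rightarrow> real) \<Rightarrow> 'x set \<Rightarrow> 'x set" where
  "ker_form a Y = {u \<in> Y. \<forall>u'\<in>Y. a u u' = 0}"

definition ker_compl ::
    "('x \<Rightarrow> 'o::real_inner) \<Rightarrow> ('x \<Rightarrow> 'x \<Rightarrow> real) \<Rightarrow> 'x set \<Rightarrow> 'x set" where
  "ker_compl j a Y = {u \<in> Y. \<forall>w\<in>ker_form a Y. inner (j u) (j w) = 0}"

definition approximating :: "(nat \<Rightarrow> 'x::real_normed_vector set) \<Rightarrow> bool" where
  "approximating Xn \<longleftrightarrow> (\<forall>u. (\<lambda>n. INF u'\<in>Xn n. norm (u - u')) \<longlonglongrightarrow> 0)"

text \<open>
  The projector \<open>P\<^sub>n\<close> for \<open>Y = Xn n\<close>. The described element exists and is unique, since \<open>a\<close> is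
  positive definite on the finite dimensional space \<open>ker_compl j a Y\<close>.
\<close>

definition form_proj ::
    "('x \<Rightarrow> 'o::real_inner) \<Rightarrow> ('x \<Rightarrow> 'x \<Rightarrow> real) \<Rightarrow> 'x set \<Rightarrow> 'x \<Rightarrow> 'x" where
  "form_proj j a Y u =
     (THE p. p \<in> ker_compl j a Y \<and> (\<forall>v\<in>ker_compl j a Y. a p v = a u v))"

definition compatible ::
    "('x::real_vector \<Rightarrow> 'x \<Rightarrow> real) \<Rightarrow> 'x set \<Rightarrow> ('x \<Rightarrow> 'x) \<Rightarrow> bool" where
  "compatible a Y Q \<longleftrightarrow>
     linear Q \<and> range Q \<subseteq> Y \<and>
     Q ` ker_form a UNIV \<subseteq> ker_form a Y \<and>
     (\<forall>u\<in>Y. u - Q u \<in> ker_form a Y)"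

definition FCO ::
    "('x::real_normed_vector \<Rightarrow> 'x \<Rightarrow> real) \<Rightarrow> (nat \<Rightarrow> 'x set) \<Rightarrow> (nat \<Rightarrow> 'x \<Rightarrow> 'x) \<Rightarrow> bool" where
  "FCO a Xn Q \<longleftrightarrow>
     (\<forall>n. compatible a (Xn n) (Q n)) \<and>
     (\<exists>C>0. \<forall>n u. norm (Q n u) \<le> C * norm u)"

definition discrete_Friedrichs ::
    "('x \<Rightarrow> 'o::real_inner) \<Rightarrow> ('x \<Rightarrow> 'x \<Rightarrow> real) \<Rightarrow> (nat \<Rightarrow> 'x set) \<Rightarrow> bool" where
  "discrete_Friedrichs j a Xn \<longleftrightarrow>
     (\<exists>C>0. \<forall>n. \<forall>v\<in>ker_compl j a (Xn n). (norm (j v))\<^sup>2 \<le> C * a v v)"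

end

theory Submission
  imports Defs
begin

text \<open>
  For (3) to (1), split \<open>v \<in> V\<^sub>n\<close> as \<open>v = v' + w'\<close> along \<open>X = V \<oplus> W\<close>. Compatibility gives
  \<open>v - Q\<^sub>n v' = (v - Q\<^sub>n v) + Q\<^sub>n w' \<in> W\<^sub>n\<close>, which is \<open>O\<close>-orthogonal to \<open>v\<close>, so
  \<open>|v|\<^sup>2 = \<langle>v, Q\<^sub>n v'\<rangle>\<close> and \<open>|v| \<le> C \<parallel>v'\<parallel>\<close>. Compactness of \<open>V \<rightarrow> O\<close> gives the Friedrichs
  inequality on \<open>V\<close>, hence \<open>\<parallel>v'\<parallel>\<^sup>2 \<le> C' a(v', v') = C' a(v, v)\<close>. For (1) to (2), \<open>P\<^sub>n\<close>
  decreases \<open>a\<close>, so DF bounds the \<open>O\<close>-norm of \<open>P\<^sub>n u\<close> as well.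
\<close>

section \<open>Orthogonal projections\<close>

text \<open>A minimizing sequence for the distance from \<open>x\<close> to \<open>S\<close> is
  Cauchy by the parallelogram law. Its limit is a nearest point, and minimality along each direction
  of \<open>S\<close> gives orthogonality.\<close>

lemma hilbert_projection:
  fixes S :: "'a::{real_inner,complete_space} set"
  assumes S: "subspace S" "closed S"
  obtains y where "y \<in> S" "\<And>z. z \<in> S \<Longrightarrow> inner (x - y) z = 0"
proof -
  define d where "d = infdist x S"
  have ne: "S \<noteq> {}" using subspace_0[OF S(1)] by auto
  have d0: "0 \<le> d" by (simp add: d_def infdist_nonneg)
  have lower: "d \<le> norm (x - s)" if "s \<in> S" for s
    using infdist_le[OF that, of x] by (simp add: d_def dist_norm)
  have lower2: "d\<^sup>2 \<le> (norm (x - s))\<^sup>2" if "s \<in> S" for s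
    using lower[OF that] d0 by (simp add: power_mono)
  have "\<exists>s\<in>S. (norm (x - s))\<^sup>2 < d\<^sup>2 + 1 / real (Suc k)" for k
  proof -
    have "d < sqrt (d\<^sup>2 + 1 / real (Suc k))"
      by (rule real_less_rsqrt) simp
    then obtain s where "s \<in> S" "dist x s < sqrt (d\<^sup>2 + 1 / real (Suc k))"
      using ne by (auto simp: d_def infdist_notempty cInf_less_iff)
    moreover from this have "(norm (x - s))\<^sup>2 < (sqrt (d\<^sup>2 + 1 / real (Suc k)))\<^sup>2"
      by (intro power_strict_mono) (auto simp: dist_norm)
    ultimately show ?thesis by auto
  qed
  then obtain y where yS: "\<And>k. y k \<in> S"
    and y: "\<And>k. (norm (x - y k))\<^sup>2 < d\<^sup>2 + 1 / real (Suc k)"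
    by metis
  have par: "(norm (y k - y l))\<^sup>2 \<le> 2 / real (Suc k) + 2 / real (Suc l)" for k l
  proof -
    let ?m = "(1/2) *\<^sub>R (y k + y l)"
    have "?m \<in> S" using S(1) yS by (intro subspace_scale subspace_add)
    then have "d\<^sup>2 \<le> (norm (x - ?m))\<^sup>2" by (rule lower2)
    \<comment> \<open>Parallelogram identity. The midpoint \<open>?m\<close> lies in
      \<open>S\<close>, hence at distance at least \<open>d\<close>, so the contributions of
      \<open>d\<close> cancel.\<close>
    moreover have "(norm (y k - y l))\<^sup>2
        = 2 * (norm (x - y k))\<^sup>2 + 2 * (norm (x - y l))\<^sup>2 - 4 * (norm (x - ?m))\<^sup>2"
      by (simp add: power2_norm_eq_inner algebra_simps inner_commute)
    ultimately show ?thesis using y[of k] y[of l] by simp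
  qed
  have "Cauchy y"
  proof (rule metric_CauchyI)
    fix e :: real assume e: "0 < e"
    obtain N where N: "4 / e\<^sup>2 < real N" using reals_Archimedean2 by blast
    have "dist (y m) (y n) < e" if "m \<ge> N" "n \<ge> N" for m n
    proof -
      have "4 / e\<^sup>2 < real (Suc m)" "4 / e\<^sup>2 < real (Suc n)"
        using that N by linarith+
      then have "2 / real (Suc m) < e\<^sup>2 / 2" "2 / real (Suc n) < e\<^sup>2 / 2"
        using e by (simp_all add: field_simps del: of_nat_Suc)
      then have "(norm (y m - y n))\<^sup>2 < e\<^sup>2" using par[of m n] by linarith
      then show ?thesis using e by (simp add: dist_norm power_less_imp_less_base)
    qed
    then show "\<exists>M. \<forall>m\<ge>M. \<forall>n\<ge>M. dist (y m) (y n) < e" by blast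
  qed
  then obtain p where p: "y \<longlonglongrightarrow> p" using Cauchy_convergent convergent_def by blast
  have pS: "p \<in> S" using S(2) yS p closed_sequentially by blast
  have "(\<lambda>k. (norm (x - y k))\<^sup>2) \<longlonglongrightarrow> (norm (x - p))\<^sup>2"
    by (intro tendsto_intros p)
  moreover have "(\<lambda>k. d\<^sup>2 + 1 / real (Suc k)) \<longlonglongrightarrow> d\<^sup>2 + 0"
    by (intro tendsto_add tendsto_const LIMSEQ_Suc lim_1_over_n)
  ultimately have "(norm (x - p))\<^sup>2 \<le> d\<^sup>2 + 0"
    by (rule LIMSEQ_le) (use y less_imp_le in blast)
  then have pd: "(norm (x - p))\<^sup>2 \<le> d\<^sup>2" by simp
  have "inner (x - p) z = 0" if z: "z \<in> S" for z
  proof (cases "z = 0")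
    case False
    \<comment> \<open>This \<open>t\<close> minimizes the quadratic polynomial giving the squared
      distance from \<open>x\<close> to \<open>p + t z\<close>.\<close>
    define t where "t = inner (x - p) z / inner z z"
    have zz: "0 < inner z z" using False by simp
    have "p + t *\<^sub>R z \<in> S" using S(1) pS z by (intro subspace_add subspace_scale)
    then have "(norm (x - p))\<^sup>2 \<le> (norm (x - (p + t *\<^sub>R z)))\<^sup>2"
      using pd lower2 by (meson order_trans)
    also have "\<dots> = (norm (x - p))\<^sup>2 - 2 * t * inner (x - p) z + t * (t * inner z z)"
      by (simp add: power2_norm_eq_inner algebra_simps inner_commute)
    also have "t * inner z z = inner (x - p) z" using zz by (simp add: t_def)
    finally have "t * inner (x - p) z \<le> 0" by simp
    then have "(inner (x - p) z)\<^sup>2 / inner z z \<le> 0" by (simp add: t_def power2_eq_square)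
    then show ?thesis using zz by (simp add: divide_le_0_iff not_le[symmetric])
  qed simp
  with pS show ?thesis using that by blast
qed

section \<open>Positive semidefinite forms and projections onto finite dimensional spaces\<close>

text \<open>Kept general because it serves twice: for \<open>a\<close>, and for the scalar product
  of X.\<close>

locale semidefinite_form =
  fixes b :: "'x::real_vector \<Rightarrow> 'x \<Rightarrow> real"
  assumes bilinear: "bilinear b"
    and sym: "b u v = b v u"
    and nonneg: "0 \<le> b u u"
begin

lemmas form_simps =
  bilinear_ladd[OF bilinear] bilinear_radd[OF bilinear]
  bilinear_lsub[OF bilinear] bilinear_rsub[OF bilinear]
  bilinear_lmul[OF bilinear] bilinear_rmul[OF bilinear]
  bilinear_lzero[OF bilinear] bilinear_rzero[OF bilinear]

text \<open>When \<open>b u u = 0\<close>, the nonnegative quantity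
  \<open>b (v + t u) (v + t u)\<close> is affine in \<open>t\<close>, so its slope
  \<open>2 * b u v\<close> must vanish.\<close>

lemma isotropic_imp_kernel:
  assumes u: "b u u = 0"
  shows "b u v = 0"
proof (rule ccontr)
  assume nz: "b u v \<noteq> 0"
  \<comment> \<open>Chosen so that the affine function takes the value -1.\<close>
  define t where "t = - (b v v + 1) / (2 * b u v)"
  have "0 \<le> b (v + t *\<^sub>R u) (v + t *\<^sub>R u)" by (rule nonneg)
  also have "\<dots> = b v v + 2 * t * b u v" using u by (simp add: form_simps sym[of v u])
  also have "\<dots> = -1" using nz by (simp add: t_def field_simps)
  finally show False by simp
qed

text \<open>One Gram-Schmidt step per vector: \<open>c\<close> is replaced by its part
  \<open>e\<close> orthogonal to \<open>span B\<close>, and \<open>y\<close> is corrected along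
  \<open>e\<close>. As \<open>b\<close> may be degenerate, the projection need not be
  unique.\<close>

lemma span_projection:
  assumes "finite B"
  shows "\<exists>y\<in>span B. \<forall>z\<in>span B. b (x - y) z = 0"
  using assms
proof (induction B arbitrary: x)
  case empty
  show ?case by (simp add: form_simps)
next
  case (insert c B)
  obtain y where y: "y \<in> span B" "\<And>z. z \<in> span B \<Longrightarrow> b (x - y) z = 0"
    using insert.IH by blast
  obtain c0 where c0: "c0 \<in> span B" "\<And>z. z \<in> span B \<Longrightarrow> b (c - c0) z = 0"
    using insert.IH by blast
  define e where "e = c - c0"
  define t where "t = b x e / b e e"
  have sub: "span B \<subseteq> span (insert c B)" by (rule span_mono) auto
  have "e \<in> span (insert c B)"
    unfolding e_def using c0(1) sub by (intro span_diff) (auto intro: span_base)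
  then have mem: "y + t *\<^sub>R e \<in> span (insert c B)"
    using y(1) sub by (intro span_add span_scale) auto
  have ye: "b y e = 0" using c0(2)[OF y(1)] sym[of y e] by (simp add: e_def)
  \<comment> \<open>If \<open>b e e = 0\<close>, division by zero makes \<open>t = 0\<close>, and
    \<open>b x e = 0\<close> because \<open>e\<close> is isotropic.\<close>
  have te: "t * b e e = b x e"
    using isotropic_imp_kernel[of e x] sym[of e x] by (cases "b e e = 0") (auto simp: t_def)
  have "b (x - (y + t *\<^sub>R e)) z = 0" if mz: "z \<in> span (insert c B)" for z
  proof -
    obtain k where k: "z - k *\<^sub>R c \<in> span B" using mz unfolding span_breakdown_eq by blast
    define z1 where "z1 = (z - k *\<^sub>R c) + k *\<^sub>R c0"
    have z1: "z1 \<in> span B" unfolding z1_def using k c0(1) by (intro span_add span_scale)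
    have z: "z = z1 + k *\<^sub>R e" by (simp add: z1_def e_def algebra_simps)
    have "b (x - y) z1 = 0" "b e z1 = 0" using y(2) c0(2) z1 by (auto simp: e_def)
    then show ?thesis using ye te by (simp add: z form_simps)
  qed
  with mem show ?case by blast
qed

lemma finite_dim_projection:
  assumes "finite_dim Y"
  obtains y where "y \<in> Y" "\<And>z. z \<in> Y \<Longrightarrow> b (x - y) z = 0"
  using assms span_projection unfolding finite_dim_def by metis

end

lemma finite_dim_subspace:
  assumes "finite_dim Y" "subspace S" "S \<subseteq> Y"
  shows "finite_dim S"
proof -
  obtain C where C: "finite C" "span C = Y" using assms(1) by (auto simp: finite_dim_def)
  obtain B where B: "B \<subseteq> S" "independent B" "S \<subseteq> span B" using maximal_independent_subset by metis
  have "finite B" using independent_span_bound[of C B] C B assms(3) by auto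
  moreover have "span B = S" using B assms(2) by (simp add: span_minimal subset_antisym)
  ultimately show ?thesis by (auto simp: finite_dim_def)
qed

section \<open>The discrete Friedrichs property\<close>

locale friedrichs_setting = semidefinite_form a
  for a :: "'x::{real_inner,complete_space} \<Rightarrow> 'x \<Rightarrow> real" +
  fixes j :: "'x \<Rightarrow> 'o::real_inner"
  assumes bounded_inclusion: "bounded_linear j"
    and bounded_form: "bounded_bilinear a"
    and inner_eq: "inner u v = inner (j u) (j v) + a u v"
begin

lemmas linear_inclusion = bounded_linear.linear[OF bounded_inclusion]

lemmas j_simps = linear_add[OF linear_inclusion] linear_diff[OF linear_inclusion]
  linear_scale[OF linear_inclusion] linear_0[OF linear_inclusion]

section \<open>The kernel of the form and its O-orthogonal complement\<close>

lemma norm_square_eq: "(norm u)\<^sup>2 = (norm (j u))\<^sup>2 + a u u"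
  by (simp add: power2_norm_eq_inner inner_eq)

lemma norm_inclusion_le: "norm (j u) \<le> norm u"
  by (rule power2_le_imp_le) (use norm_square_eq[of u] nonneg[of u] in simp_all)

text \<open>Isotropic vectors are orthogonal to all of X, so membership in the kernel does not
  depend on the test space. In particular W_n is the intersection of X_n and W.\<close>

lemma ker_form_eq: "ker_form a Y = Y \<inter> {u. a u u = 0}"
  using isotropic_imp_kernel by (auto simp: ker_form_def)

lemma ker_form_left: "w \<in> ker_form a Y \<Longrightarrow> a w u = 0"
  using isotropic_imp_kernel by (auto simp: ker_form_eq)

lemma ker_form_right: "w \<in> ker_form a Y \<Longrightarrow> a u w = 0"
  using ker_form_left[of w Y u] sym[of u w] by simp

lemma ker_form_subset: "ker_form a Y \<subseteq> Y"
  by (auto simp: ker_form_def)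

lemma subspace_ker_form: "subspace Y \<Longrightarrow> subspace (ker_form a Y)"
  by (auto simp: ker_form_def subspace_def form_simps)

lemma subspace_ker_compl: "subspace Y \<Longrightarrow> subspace (ker_compl j a Y)"
  by (auto simp: ker_compl_def subspace_def j_simps inner_simps)

text \<open>Orthogonality to the kernel is thus the same in X and in O, so V and V_n can be reached
  by projections in X.\<close>

lemma inner_ker_form: "w \<in> ker_form a Y \<Longrightarrow> inner u w = inner (j u) (j w)"
  by (simp add: inner_eq ker_form_right)

text \<open>An isotropic vector of the complement lies in the kernel too, hence is O-orthogonal to
  itself, and both parts of its X-norm vanish.\<close>

lemma ker_compl_definite:
  assumes "v \<in> ker_compl j a Y" "a v v = 0"
  shows "v = 0"
proof -
  have "v \<in> ker_form a Y" using assms by (auto simp: ker_form_eq ker_compl_def)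
  then have "inner (j v) (j v) = 0" using assms(1) by (auto simp: ker_compl_def)
  then show ?thesis using norm_square_eq[of v] assms(2) by simp
qed

lemma closed_ker_form: "closed (ker_form a UNIV)"
proof -
  have "ker_form a UNIV = (\<Inter>v. {u. a u v = 0})" by (auto simp: ker_form_def)
  moreover have "closed {u. a u v = 0}" for v
    by (intro closed_Collect_eq continuous_on_const
        bounded_linear.continuous_on[OF bounded_bilinear.bounded_linear_left[OF bounded_form]] continuous_on_id)
  ultimately show ?thesis by (simp add: closed_INT)
qed

lemma closed_ker_compl: "closed (ker_compl j a UNIV)"
proof -
  have "ker_compl j a UNIV = (\<Inter>w\<in>ker_form a UNIV. {u. inner (j u) (j w) = 0})"
    by (auto simp: ker_compl_def)
  moreover have "closed {u. inner (j u) (j w) = 0}" for w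
    by (intro closed_Collect_eq continuous_intros
        bounded_linear.continuous_on[OF bounded_inclusion])
  ultimately show ?thesis by (simp add: closed_INT)
qed

text \<open>W is closed in X, so \<open>u\<close> has an X-orthogonal projection on W; the remainder
  is O-orthogonal to W by \<open>inner_ker_form\<close>.\<close>

lemma decomposition:
  obtains v w where "v \<in> ker_compl j a UNIV" "w \<in> ker_form a UNIV" "u = v + w"
proof -
  obtain w where w: "w \<in> ker_form a UNIV" "\<And>z. z \<in> ker_form a UNIV \<Longrightarrow> inner (u - w) z = 0"
    using hilbert_projection[OF subspace_ker_form[OF subspace_UNIV] closed_ker_form] by blast
  then have "u - w \<in> ker_compl j a UNIV"
    by (auto simp: ker_compl_def simp flip: inner_ker_form)
  with w(1) show ?thesis using that[of "u - w" w] by simp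
qed

lemma discrete_decomposition:
  assumes Y: "subspace Y" "finite_dim Y" and u: "u \<in> Y"
  obtains v w where "v \<in> ker_compl j a Y" "w \<in> ker_form a Y" "u = v + w"
proof -
  interpret X: semidefinite_form "inner :: 'x \<Rightarrow> 'x \<Rightarrow> real"
    by unfold_locales (auto simp: bilinear_def inner_commute inner_simps intro!: linearI)
  obtain w where w: "w \<in> ker_form a Y" "\<And>z. z \<in> ker_form a Y \<Longrightarrow> inner (u - w) z = 0"
    using X.finite_dim_projection[OF finite_dim_subspace[OF Y(2) subspace_ker_form[OF Y(1)] ker_form_subset]]
    by blast
  moreover have "u - w \<in> Y" using Y(1) u w(1) ker_form_subset by (blast intro: subspace_diff)
  ultimately have "u - w \<in> ker_compl j a Y"
    by (auto simp: ker_compl_def simp flip: inner_ker_form)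
  with w(1) show ?thesis using that[of "u - w" w] by simp
qed

section \<open>The projector P_n\<close>

text \<open>The difference of two candidates is isotropic and lies in the complement, where
  \<open>a\<close> is definite. Values of P_n can therefore be identified by checking its defining
  property.\<close>

lemma form_proj_eqI:
  assumes Y: "subspace Y"
    and p: "p \<in> ker_compl j a Y" "\<And>v. v \<in> ker_compl j a Y \<Longrightarrow> a p v = a u v"
  shows "form_proj j a Y u = p"
  unfolding form_proj_def
proof (rule the_equality)
  fix q assume q: "q \<in> ker_compl j a Y \<and> (\<forall>v\<in>ker_compl j a Y. a q v = a u v)"
  have mem: "q - p \<in> ker_compl j a Y" using q p(1) by (simp add: subspace_diff subspace_ker_compl Y)
  then have "a (q - p) (q - p) = 0"
    using q p(2)[OF mem] by (simp add: form_simps(3))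
  with mem show "q = p" using ker_compl_definite by fastforce
qed (use p in simp)

text \<open>For existence, project \<open>u\<close> onto \<open>Y\<close> with respect to
  \<open>a\<close>, then discard the component in the kernel, which \<open>a\<close> does not
  see.\<close>

lemma form_proj:
  assumes Y: "subspace Y" "finite_dim Y"
  shows "form_proj j a Y u \<in> ker_compl j a Y"
    and "v \<in> ker_compl j a Y \<Longrightarrow> a (form_proj j a Y u) v = a u v"
proof -
  obtain y where y: "y \<in> Y" "\<And>z. z \<in> Y \<Longrightarrow> a (u - y) z = 0"
    using finite_dim_projection[OF Y(2)] by blast
  obtain p w where pw: "p \<in> ker_compl j a Y" "w \<in> ker_form a Y" "y = p + w"
    using discrete_decomposition[OF Y y(1)] by blast
  have pv: "a p v = a u v" if "v \<in> ker_compl j a Y" for v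
    using that y(2)[of v] ker_form_left[OF pw(2)] by (simp add: pw(3) form_simps ker_compl_def)
  then have "form_proj j a Y u = p" using form_proj_eqI Y(1) pw(1) by blast
  with pw(1) pv show "form_proj j a Y u \<in> ker_compl j a Y"
    "v \<in> ker_compl j a Y \<Longrightarrow> a (form_proj j a Y u) v = a u v" by auto
qed

text \<open>Everything follows from uniqueness: on W the value 0 qualifies, and for \<open>u\<close>
  in \<open>Y\<close> the component of \<open>u\<close> in \<open>ker_compl j a Y\<close> does,
  leaving the kernel component as \<open>u - P_n u\<close>.\<close>

lemma compatible_form_proj:
  assumes Y: "subspace Y" "finite_dim Y"
  shows "compatible a Y (form_proj j a Y)"
proof -
  note P = form_proj[OF Y] and V = subspace_ker_compl[OF Y(1)]
  have "linear (form_proj j a Y)"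
    by (intro linearI form_proj_eqI Y)
      (auto simp: form_simps P intro!: subspace_add subspace_scale V)
  moreover have "form_proj j a Y u \<in> Y" for u
    using P(1) by (auto simp: ker_compl_def)
  moreover have "form_proj j a Y w \<in> ker_form a Y" if "w \<in> ker_form a UNIV" for w
  proof -
    have "form_proj j a Y w = 0"
      using ker_form_left[OF that] subspace_0[OF V] by (intro form_proj_eqI Y) (auto simp: form_simps)
    then show ?thesis using subspace_0[OF subspace_ker_form[OF Y(1)]] by simp
  qed
  moreover have "u - form_proj j a Y u \<in> ker_form a Y" if u: "u \<in> Y" for u
  proof -
    obtain v w where vw: "v \<in> ker_compl j a Y" "w \<in> ker_form a Y" "u = v + w"
      using discrete_decomposition[OF Y u] by blast
    have "form_proj j a Y u = v"
      using vw ker_form_left[OF vw(2)] by (intro form_proj_eqI Y) (auto simp: form_simps)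
    then show ?thesis using vw by simp
  qed
  ultimately show ?thesis by (auto simp: compatible_def)
qed

text \<open>Since \<open>a u ?p = a ?p ?p\<close>, the nonnegative
  \<open>a (u - ?p) (u - ?p)\<close> equals \<open>a u u - a ?p ?p\<close>.\<close>

lemma form_proj_decreasing:
  assumes Y: "subspace Y" "finite_dim Y"
  shows "a (form_proj j a Y u) (form_proj j a Y u) \<le> a u u"
proof -
  let ?p = "form_proj j a Y u"
  have "a ?p ?p = a u ?p" using form_proj[OF Y] by blast
  then show ?thesis using nonneg[of "u - ?p"] sym[of u ?p] by (simp add: form_simps)
qed

lemma DF_imp_FCO:
  assumes Xn: "\<And>n. subspace (Xn n)" "\<And>n. finite_dim (Xn n)"
    and DF: "discrete_Friedrichs j a Xn"
  shows "FCO a Xn (\<lambda>n. form_proj j a (Xn n))"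
proof -
  obtain C where C: "C > 0" "\<And>n v. v \<in> ker_compl j a (Xn n) \<Longrightarrow> (norm (j v))\<^sup>2 \<le> C * a v v"
    using DF by (auto simp: discrete_Friedrichs_def)
  \<comment> \<open>In \<open>C + 1\<close>, the \<open>C\<close> bounds the O-part of the squared
    X-norm and the 1 accounts for \<open>a ?p ?p\<close> itself.\<close>
  have "norm (form_proj j a (Xn n) u) \<le> sqrt (C + 1) * norm u" for n u
  proof -
    let ?p = "form_proj j a (Xn n) u"
    have "(norm ?p)\<^sup>2 \<le> (C + 1) * a ?p ?p"
      using C(2)[OF form_proj(1)[OF Xn]] by (simp add: norm_square_eq algebra_simps)
    also have "\<dots> \<le> (C + 1) * (norm u)\<^sup>2"
      using form_proj_decreasing[OF Xn, of n u] norm_square_eq[of u] C(1)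
      by (intro mult_left_mono) (auto intro: order_trans[of _ "a u u"])
    also have "\<dots> = (sqrt (C + 1) * norm u)\<^sup>2" using C(1) by (simp add: power_mult_distrib)
    finally show ?thesis by (rule power2_le_imp_le) (use C(1) in simp)
  qed
  then show ?thesis
    using C(1) compatible_form_proj[OF Xn] unfolding FCO_def
    by (intro conjI allI exI[of _ "sqrt (C + 1)"]) auto
qed

section \<open>The Friedrichs inequality on V\<close>

text \<open>Otherwise there are O-unit vectors of V with \<open>a v v\<close> tending to 0.
  Compactness gives a subsequence converging in O, which then converges in X. Its limit is isotropic
  in V, hence 0, yet has O-norm 1.\<close>

lemma continuous_Friedrichs:
  assumes compact: "compact_on (ker_compl j a UNIV) j"
  shows "\<exists>C>0. \<forall>v\<in>ker_compl j a UNIV. (norm (j v))\<^sup>2 \<le> C * a v v"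
proof (rule ccontr)
  assume "\<not> ?thesis"
  then have neg: "\<exists>v\<in>ker_compl j a UNIV. C * a v v < (norm (j v))\<^sup>2" if "C > 0" for C
    using that by (meson not_le)
  have "\<exists>v\<in>ker_compl j a UNIV. norm (j v) = 1 \<and> a v v < 1 / real (Suc k)" for k
  proof -
    obtain v where v: "v \<in> ker_compl j a UNIV" "real (Suc k) * a v v < (norm (j v))\<^sup>2"
      using neg[of "real (Suc k)"] by auto
    \<comment> \<open>With the strict inequality \<open>v(2)\<close> this excludes
      \<open>j v = 0\<close>, so that \<open>v\<close> can be normalized in O.\<close>
    have "0 \<le> real (Suc k) * a v v" using nonneg by (intro mult_nonneg_nonneg) auto
    with v(2) have pos: "0 < norm (j v)" by (cases "norm (j v) = 0") auto
    let ?v = "(1 / norm (j v)) *\<^sub>R v"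
    have "?v \<in> ker_compl j a UNIV"
      using v(1) by (intro subspace_scale subspace_ker_compl subspace_UNIV)
    moreover have "norm (j ?v) = 1" using pos by (simp add: j_simps)
    moreover have "a ?v ?v < 1 / real (Suc k)"
      using v(2) pos by (simp add: form_simps field_simps power2_eq_square)
    ultimately show ?thesis by blast
  qed
  then obtain v where v: "\<And>k. v k \<in> ker_compl j a UNIV" "\<And>k. norm (j (v k)) = 1"
    "\<And>k. a (v k) (v k) < 1 / real (Suc k)"
    by metis
  have "(norm (v k))\<^sup>2 \<le> 2\<^sup>2" for k
  proof -
    have "1 / real (Suc k) \<le> 1" by simp
    then have "a (v k) (v k) \<le> 1" using v(3)[of k] by linarith
    then show ?thesis using v(2)[of k] by (simp add: norm_square_eq)
  qed
  then have "norm (v k) \<le> 2" for k by (rule power2_le_imp_le) simp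
  then have "bounded (range v)" unfolding bounded_iff by blast
  then have "seq_compact (closure (j ` range v))"
    using compact v(1) unfolding compact_on_def compact_eq_seq_compact_metric by blast
  moreover have "\<forall>k. (j \<circ> v) k \<in> closure (j ` range v)" by (simp add: closure_def)
  ultimately obtain l r where r: "strict_mono r" "((j \<circ> v) \<circ> r) \<longlonglongrightarrow> l"
    by (rule seq_compactE)
  then have jr: "(\<lambda>k. j (v (r k))) \<longlonglongrightarrow> l" by (simp add: comp_def)
  have a0: "(\<lambda>k. a (v (r k)) (v (r k))) \<longlonglongrightarrow> 0"
  proof -
    have "(\<lambda>k. a (v k) (v k)) \<longlonglongrightarrow> 0"
      by (rule tendsto_sandwich[OF _ _ tendsto_const LIMSEQ_Suc[OF lim_1_over_n]])
        (use v(3) nonneg in \<open>auto intro!: always_eventually less_imp_le\<close>)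
    from LIMSEQ_subseq_LIMSEQ[OF this r(1)] show ?thesis by (simp add: comp_def)
  qed
  \<comment> \<open>The parallelogram identity for \<open>a\<close> with the nonnegative term
    \<open>a (x + y) (x + y)\<close> dropped.\<close>
  have par: "a (x - y) (x - y) \<le> 2 * a x x + 2 * a y y" for x y
    using nonneg[of "x + y"] sym[of x y] by (simp add: form_simps)
  \<comment> \<open>So far \<open>l\<close> is only a point of O. Convergence in O together with
    \<open>a0\<close> controls both parts of the X-norm, and completeness of X then provides a limit
    in X.\<close>
  have "Cauchy (\<lambda>k. v (r k))"
  proof (rule metric_CauchyI)
    fix e :: real assume e: "0 < e"
    have "Cauchy (\<lambda>k. j (v (r k)))" using jr by (rule LIMSEQ_imp_Cauchy)
    from metric_CauchyD[OF this, of "e / 2"] e obtain M1 where M1: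
      "\<And>m n. m \<ge> M1 \<Longrightarrow> n \<ge> M1 \<Longrightarrow> norm (j (v (r m)) - j (v (r n))) < e / 2"
      by (auto simp: dist_norm)
    \<comment> \<open>By \<open>par\<close>, the bound \<open>e\<^sup>2 / 8\<close> leaves at most
      \<open>e\<^sup>2 / 2\<close> for the \<open>a\<close>-part; the O-part adds
      \<open>e\<^sup>2 / 4\<close>.\<close>
    have "\<forall>\<^sub>F k in sequentially. a (v (r k)) (v (r k)) < e\<^sup>2 / 8"
      using a0 e by (intro order_tendstoD) auto
    then obtain M2 where M2: "\<And>k. k \<ge> M2 \<Longrightarrow> a (v (r k)) (v (r k)) < e\<^sup>2 / 8"
      by (auto simp: eventually_sequentially)
    have "dist (v (r m)) (v (r n)) < e" if "m \<ge> max M1 M2" "n \<ge> max M1 M2" for m n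
    proof -
      have "(norm (j (v (r m)) - j (v (r n))))\<^sup>2 < (e / 2)\<^sup>2"
        using M1[of m n] that by (intro power_strict_mono) auto
      moreover have "a (v (r m)) (v (r m)) < e\<^sup>2 / 8" "a (v (r n)) (v (r n)) < e\<^sup>2 / 8"
        using M2 that by auto
      moreover have "0 < e\<^sup>2" "(e / 2)\<^sup>2 = e\<^sup>2 / 4" using e by (simp_all add: power_divide)
      ultimately have "(norm (v (r m) - v (r n)))\<^sup>2 < e\<^sup>2"
        unfolding norm_square_eq j_simps using par[of "v (r m)" "v (r n)"] by linarith
      then show ?thesis using e by (simp add: dist_norm power_less_imp_less_base)
    qed
    then show "\<exists>M. \<forall>m\<ge>M. \<forall>n\<ge>M. dist (v (r m)) (v (r n)) < e" by blast
  qed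
  then obtain p where p: "(\<lambda>k. v (r k)) \<longlonglongrightarrow> p"
    using Cauchy_convergent convergent_def by blast
  have "p \<in> ker_compl j a UNIV"
    using closed_sequentially[OF closed_ker_compl _ p] v(1) by blast
  moreover have "a p p = 0"
    using LIMSEQ_unique[OF a0 bounded_bilinear.tendsto[OF bounded_form p p]] by simp
  ultimately have "p = 0" by (rule ker_compl_definite)
  moreover have "(\<lambda>k. norm (j (v (r k)))) \<longlonglongrightarrow> norm (j p)"
    by (intro tendsto_norm bounded_linear.tendsto[OF bounded_inclusion] p)
  ultimately show False using v(2) by (simp add: j_simps LIMSEQ_const_iff)
qed

section \<open>From compatible operators to the discrete Friedrichs inequality\<close>

lemma FCO_imp_DF:
  assumes Xn: "\<And>n. subspace (Xn n)"
    and compact: "compact_on (ker_compl j a UNIV) j"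
    and FCO: "FCO a Xn Q"
  shows "discrete_Friedrichs j a Xn"
proof -
  obtain C where C: "C > 0" "\<And>n u. norm (Q n u) \<le> C * norm u"
    and Q: "\<And>n. compatible a (Xn n) (Q n)"
    using FCO by (auto simp: FCO_def)
  obtain D where D: "D > 0" "\<And>v. v \<in> ker_compl j a UNIV \<Longrightarrow> (norm (j v))\<^sup>2 \<le> D * a v v"
    using continuous_Friedrichs[OF compact] by blast
  \<comment> \<open>\<open>C\<^sup>2\<close> comes from the uniform bound on the operators, and
    \<open>D + 1\<close> from bounding the squared X-norm on V by \<open>a\<close>. Neither depends
    on \<open>n\<close>.\<close>
  have "(norm (j v))\<^sup>2 \<le> C\<^sup>2 * (D + 1) * a v v" if v: "v \<in> ker_compl j a (Xn n)" for n v
  proof -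
    obtain v' w where vw: "v' \<in> ker_compl j a UNIV" "w \<in> ker_form a UNIV" "v = v' + w"
      using decomposition by blast
    have vX: "v \<in> Xn n" using v by (simp add: ker_compl_def)
    have "Q n v = Q n v' + Q n w"
      using Q by (simp add: compatible_def vw(3) linear_add)
    then have "v - Q n v' = (v - Q n v) + Q n w" by simp
    moreover have "v - Q n v \<in> ker_form a (Xn n)" "Q n w \<in> ker_form a (Xn n)"
      using Q[of n] vX vw(2) by (auto simp: compatible_def)
    ultimately have "v - Q n v' \<in> ker_form a (Xn n)"
      using subspace_add[OF subspace_ker_form[OF Xn]] by metis
    then have "inner (j v) (j (v - Q n v')) = 0" using v by (simp add: ker_compl_def)
    then have "(norm (j v))\<^sup>2 = inner (j v) (j (Q n v'))"
      by (simp add: j_simps inner_simps power2_norm_eq_inner)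
    also have "\<dots> \<le> norm (j v) * norm (j (Q n v'))" by (rule norm_cauchy_schwarz)
    \<comment> \<open>One factor \<open>norm (j v)\<close> is cancelled; if it is zero the claim is
      trivial.\<close>
    finally have "norm (j v) \<le> norm (j (Q n v'))"
      by (cases "norm (j v) = 0") (auto simp: power2_eq_square)
    also have "\<dots> \<le> C * norm v'" using norm_inclusion_le C(2) by (rule order_trans)
    finally have "(norm (j v))\<^sup>2 \<le> (C * norm v')\<^sup>2" by (simp add: power_mono)
    also have "\<dots> = C\<^sup>2 * ((norm (j v'))\<^sup>2 + a v' v')"
      by (simp add: power_mult_distrib norm_square_eq)
    also have "\<dots> \<le> C\<^sup>2 * ((D + 1) * a v' v')"
      using D(2)[OF vw(1)] by (intro mult_left_mono) (auto simp: algebra_simps)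
    \<comment> \<open>Passing from V_n to V changes \<open>v\<close> only by \<open>w\<close> in W,
      so the value of \<open>a\<close> is preserved.\<close>
    also have "a v' v' = a v v"
      using ker_form_left[OF vw(2)] ker_form_right[OF vw(2)] by (simp add: vw(3) form_simps)
    finally show ?thesis by (simp add: mult.assoc)
  qed
  then show ?thesis
    unfolding discrete_Friedrichs_def using C(1) D(1)
    by (intro exI[of _ "C\<^sup>2 * (D + 1)"]) auto
qed

end

theorem proposition15:
  fixes j :: "'x::{real_inner,complete_space} \<Rightarrow> 'o::{real_inner,complete_space}"
    and a :: "'x \<Rightarrow> 'x \<Rightarrow> real"
    and Xn :: "nat \<Rightarrow> 'x set"
  assumes O_infinite_dim: "\<not> finite_dim (UNIV :: 'o set)"
    and O_separable: "\<exists>D :: 'o set. countable D \<and> closure D = UNIV"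
    and inclusion: "bounded_linear j" "inj j"
    and dense: "closure (range j) = UNIV"
    and form_continuous: "bounded_bilinear a"
    and form_symmetric: "\<And>u v. a u v = a v u"
    and form_nonneg: "\<And>u. 0 \<le> a u u"
    and inner_X: "\<And>u v. inner u v = inner (j u) (j v) + a u v"
    and compact_V: "compact_on (ker_compl j a UNIV) j"
    and Xn_subspace: "\<And>n. subspace (Xn n)"
    and Xn_finite_dim: "\<And>n. finite_dim (Xn n)"
    and AS: "approximating Xn"
  shows "(discrete_Friedrichs j a Xn \<longleftrightarrow> FCO a Xn (\<lambda>n. form_proj j a (Xn n))) \<and>
         (FCO a Xn (\<lambda>n. form_proj j a (Xn n)) \<longleftrightarrow> (\<exists>Q. FCO a Xn Q))"
proof -
  have "linear (a x)" "linear (\<lambda>x. a x y)" for x y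
    using bounded_bilinear.bounded_linear_right[OF form_continuous]
      bounded_bilinear.bounded_linear_left[OF form_continuous]
    by (auto intro: bounded_linear.linear)
  then have "bilinear a" by (simp add: bilinear_def)
  then have "semidefinite_form a"
    using form_symmetric form_nonneg unfolding semidefinite_form_def by blast
  then interpret friedrichs_setting a j
    using inclusion(1) form_continuous inner_X
    unfolding friedrichs_setting_def friedrichs_setting_axioms_def by blast
  have DF_FCO: "discrete_Friedrichs j a Xn \<Longrightarrow> FCO a Xn (\<lambda>n. form_proj j a (Xn n))"
    using Xn_subspace Xn_finite_dim by (rule DF_imp_FCO)
  have "FCO a Xn Q \<Longrightarrow> discrete_Friedrichs j a Xn" for Q
    using Xn_subspace compact_V by (rule FCO_imp_DF)
  \<comment> \<open>The remaining implication, from (2) to (3), takes the projectors themselves as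
    witness and closes the cycle.\<close>
  with DF_FCO show ?thesis by metis
qed

end
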